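(* Let $Y$ be a real random variable whose moment generating function $E[e^{tY}]$ exists for $|t|<r$, for some $r>0$. Then for any integer $n\ge 0$ and every real $x$, $$B_{n+1}^{(L,Y)}(x)=x\sum_{k=0}^{n}\binom{n}{k}E\big[\langle Y\rangle_{k+1}\big]B_{n-k}^{(L,Y)}(x).$$
   Context: Rising factorial: $\langle x\rangle_0=1$, $\langle x\rangle_n=x(x+1)\cdots(x+n-1)$ for $n\ge 1$. The probabilistic Lah numbers $L_Y(n,k)$ ($n\ge k\ge 0$) associated with $Y$ are defined by the power series expansion about $t=0$ $$\frac{1}{k!}\left(E\left[\left(\frac{1}{1-t}\right)^{Y}\right]-1\right)^{k}=\sum_{n=k}^{\infty}L_{Y}(n,k)\frac{t^{n}}{n!},\quad k\ge 0.$$ The probabilistic Lah-Bell polynomials associated with $Y$ are $B_{n}^{(L,Y)}(x)=\sum_{k=0}^{n}L_{Y}(n,k)x^{k}$, $n\ge 0$. *)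

theory Defs
  imports "HOL-Probability.Probability"
begin

definition lah_gf :: "'a measure \<Rightarrow> ('a \<Rightarrow> real) \<Rightarrow> nat \<Rightarrow> real \<Rightarrow> real" where
  "lah_gf M Y k t = 1 / fact k * ((\<integral>\<omega>. (1 / (1 - t)) powr Y \<omega> \<partial>M) - 1) ^ k"

text \<open>The coefficient sequence of the expansion starting at \<open>n = k\<close> is determined by the
  expansion only for \<open>n \<ge> k\<close>; the values for \<open>n < k\<close> are set to \<open>0\<close>. The power series is
  required to converge to the generating function on some neighbourhood of \<open>0\<close>.\<close>

definition is_lah_expansion ::
    "'a measure \<Rightarrow> ('a \<Rightarrow> real) \<Rightarrow> nat \<Rightarrow> (nat \<Rightarrow> real) \<Rightarrow> bool" where
  "is_lah_expansion M Y k c \<longleftrightarrow>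
     (\<forall>n<k. c n = 0) \<and>
     (\<forall>\<^sub>F t in nhds 0. (\<lambda>i. c (i + k) * (t ^ (i + k) / fact (i + k))) sums lah_gf M Y k t)"

definition prob_lah :: "'a measure \<Rightarrow> ('a \<Rightarrow> real) \<Rightarrow> nat \<Rightarrow> nat \<Rightarrow> real" where
  "prob_lah M Y n k = (THE c. is_lah_expansion M Y k c) n"

definition prob_lah_bell :: "'a measure \<Rightarrow> ('a \<Rightarrow> real) \<Rightarrow> nat \<Rightarrow> real \<Rightarrow> real" where
  "prob_lah_bell M Y n x = (\<Sum>k=0..n. prob_lah M Y n k * x ^ k)"

end

theory Submission imports Defs begin

text \<open>The rising factorials are the Taylor coefficients of \<open>(1 / (1 - t)) powr y\<close>, and dominated
  convergence carries this over to expectations: near \<open>0\<close> the exponential generating function of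
  \<open>E[pochhammer Y n]\<close> is \<open>E[(1 / (1 - t)) powr Y]\<close>. Hence, with \<open>G\<close> the formal power series of this
  function minus \<open>1\<close>, the Lah-Bell polynomials at \<open>x\<close> have the exponential generating function
  \<open>exp (x G)\<close>. Its derivative is \<open>x G' exp (x G)\<close>, and comparing coefficients gives the recurrence.\<close>

lemma has_fps_expansion_power:
  fixes f :: "'a :: {banach, real_normed_div_algebra, comm_ring_1} \<Rightarrow> 'a"
  assumes "f has_fps_expansion F"
  shows "(\<lambda>x. f x ^ k) has_fps_expansion F ^ k"
  by (induction k) (auto intro!: has_fps_expansion_mult assms)

text \<open>Dividing by \<open>x ^ n\<close>, with \<open>n\<close> the subdegree, moves the first
  nonzero coefficient \<open>c\<close> to the constant term. The quotient has value \<open>c\<close>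
  at 0 and vanishes elsewhere, yet must be continuous at 0.\<close>

lemma has_fps_expansion_zero_imp_zero:
  fixes F :: "'a :: {banach, real_normed_field} fps"
  assumes "(\<lambda>_. 0) has_fps_expansion F"
  shows "F = 0"
proof (rule ccontr)
  assume "F \<noteq> 0"
  define n c where "n = subdegree F" and "c = fps_nth F n"
  have "c \<noteq> 0"
    using \<open>F \<noteq> 0\<close> by (simp add: n_def c_def)
  have "(\<lambda>x. if x = 0 then c else 0 / x ^ n) has_fps_expansion fps_shift n F"
    using assms by (rule has_fps_expansion_shift) (simp_all add: n_def c_def)
  from has_fps_expansion_imp_continuous[OF this, of UNIV]
  have "isCont (\<lambda>x::'a. if x = 0 then c else 0) 0"
    by (simp cong: if_cong)
  then have "(\<lambda>x::'a. if x = 0 then c else 0) \<midarrow>0\<rightarrow> c"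
    by (simp add: isCont_def)
  moreover have "(\<lambda>x::'a. if x = 0 then c else 0) \<midarrow>0\<rightarrow> 0"
    by (rule tendsto_eventually) (auto simp: eventually_at_filter)
  ultimately show False
    using \<open>c \<noteq> 0\<close> LIM_unique by blast
qed

lemma has_fps_expansion_unique:
  fixes F G :: "'a :: {banach, real_normed_field} fps"
  assumes "f has_fps_expansion F" "f has_fps_expansion G"
  shows "F = G"
  using has_fps_expansion_zero_imp_zero[of "F - G"] has_fps_expansion_diff[OF assms] by simp

lemma has_fps_expansion_imp_sums:
  assumes "f has_fps_expansion F"
  shows "\<forall>\<^sub>F t in nhds 0. (\<lambda>n. fps_nth F n * t ^ n) sums f t"
proof -
  have "\<forall>\<^sub>F t in nhds 0. t \<in> eball 0 (fps_conv_radius F)"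
    using assms by (intro eventually_nhds_in_open) (auto simp: has_fps_expansion_def zero_ereal_def)
  moreover have "\<forall>\<^sub>F t in nhds 0. eval_fps F t = f t"
    using assms by (simp add: has_fps_expansion_def)
  ultimately show ?thesis
  proof eventually_elim
    case (elim t)
    then show ?case
      using sums_eval_fps[of t F] by simp
  qed
qed

text \<open>Newton's binomial series with exponent \<open>- y\<close> at \<open>- t\<close>: the
  sign \<open>(-1) ^ n\<close> in \<open>- y gchoose n\<close> cancels against that of
  \<open>(- t) ^ n\<close>.\<close>

lemma pochhammer_sums_powr:
  fixes y t :: real
  assumes "\<bar>t\<bar> < 1"
  shows "(\<lambda>n. pochhammer y n * t ^ n / fact n) sums (1 / (1 - t)) powr y"
proof -
  have "(\<lambda>n. (- y gchoose n) * (- t) ^ n) sums (1 + - t) powr (- y)"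
    using assms by (intro gen_binomial_real) simp
  moreover have "(- y gchoose n) * (- t) ^ n = pochhammer y n * t ^ n / fact n" for n
    by (simp add: gbinomial_pochhammer power_minus[of t] mult_ac)
  moreover have "(1 + - t) powr (- y) = (1 / (1 - t)) powr y"
    using assms by (simp add: powr_minus powr_divide field_simps)
  ultimately show ?thesis
    by simp
qed

lemma abs_pochhammer_le: "\<bar>pochhammer y n\<bar> \<le> pochhammer \<bar>y\<bar> n" for y :: real
  by (induction n) (auto simp: pochhammer_Suc abs_mult intro!: mult_mono)

text \<open>Pointwise, \<open>exp (s * \<bar>Y \<omega>\<bar>)\<close> is one of the two given
  exponentials, hence at most their sum.\<close>

lemma integrable_exp_abs:
  fixes Y :: "'a \<Rightarrow> real"
  assumes [measurable]: "Y \<in> borel_measurable M"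
    and "integrable M (\<lambda>\<omega>. exp (s * Y \<omega>))" "integrable M (\<lambda>\<omega>. exp (- s * Y \<omega>))"
  shows "integrable M (\<lambda>\<omega>. exp (s * \<bar>Y \<omega>\<bar>))"
proof (rule Bochner_Integration.integrable_bound)
  show "integrable M (\<lambda>\<omega>. exp (s * Y \<omega>) + exp (- s * Y \<omega>))"
    using assms by (intro Bochner_Integration.integrable_add)
  show "AE \<omega> in M. norm (exp (s * \<bar>Y \<omega>\<bar>)) \<le> norm (exp (s * Y \<omega>) + exp (- s * Y \<omega>))"
    by (intro AE_I2) (simp add: add_pos_pos abs_of_pos abs_real_def[of "Y _"])
qed simp

lemma powr_abs_integrable:
  fixes Y :: "'a \<Rightarrow> real"
  assumes "Y \<in> borel_measurable M"
    and "\<And>t. \<bar>t\<bar> < r \<Longrightarrow> integrable M (\<lambda>\<omega>. exp (t * Y \<omega>))"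
    and t: "\<bar>t\<bar> < 1 - exp (- r)"
  shows "integrable M (\<lambda>\<omega>. (1 / (1 - \<bar>t\<bar>)) powr \<bar>Y \<omega>\<bar>)"
proof -
  \<comment> \<open>With this \<open>s\<close> the power becomes
    \<open>exp (s * \<bar>Y \<omega>\<bar>)\<close>, and \<open>s < r\<close> amounts to
    \<open>\<bar>t\<bar> < 1 - exp (- r)\<close>; this is where the radius comes from.\<close>
  define s where "s = - ln (1 - \<bar>t\<bar>)"
  have t1: "\<bar>t\<bar> < 1"
    using t exp_gt_zero[of "- r"] by linarith
  have "exp (- r) < 1 - \<bar>t\<bar>"
    using t by simp
  then have "s < r"
    using t1 ln_less_cancel_iff[of "exp (- r)" "1 - \<bar>t\<bar>"] by (simp add: s_def)
  moreover have "0 \<le> s"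
    using t1 by (simp add: s_def)
  ultimately have "integrable M (\<lambda>\<omega>. exp (s * \<bar>Y \<omega>\<bar>))"
    using assms(1) assms(2)[of s] assms(2)[of "- s"] by (intro integrable_exp_abs) auto
  then show ?thesis
    using t1 by (simp add: powr_def s_def ln_div mult.commute)
qed

text \<open>Passing to \<open>\<bar>y\<bar>\<close> and \<open>\<bar>t\<bar>\<close> makes all terms
  nonnegative, so partial sums stay below the full binomial series. The bound does not depend on
  \<open>N\<close>, as a majorant for dominated convergence requires.\<close>

lemma pochhammer_partial_sum_le:
  fixes y t :: real
  assumes "\<bar>t\<bar> < 1"
  shows "(\<Sum>n<N. \<bar>pochhammer y n * t ^ n / fact n\<bar>) \<le> (1 / (1 - \<bar>t\<bar>)) powr \<bar>y\<bar>"
proof -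
  have "(\<Sum>n<N. \<bar>pochhammer y n * t ^ n / fact n\<bar>) \<le> (\<Sum>n<N. pochhammer \<bar>y\<bar> n * \<bar>t\<bar> ^ n / fact n)"
    by (intro sum_mono) (simp add: abs_mult power_abs divide_right_mono mult_right_mono abs_pochhammer_le)
  also have "\<dots> \<le> (1 / (1 - \<bar>t\<bar>)) powr \<bar>y\<bar>"
  proof -
    have 0: "0 \<le> pochhammer \<bar>y\<bar> n * \<bar>t\<bar> ^ n / fact n" for n
      using order_trans[OF abs_ge_zero abs_pochhammer_le[of y n]] by simp
    show ?thesis
      using sum_le_suminf[of "\<lambda>n. pochhammer \<bar>y\<bar> n * \<bar>t\<bar> ^ n / fact n" "{..<N}"]
        pochhammer_sums_powr[of "\<bar>t\<bar>" "\<bar>y\<bar>"] assms 0 by (auto simp: sums_iff)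
  qed
  finally show ?thesis .
qed

lemma pochhammer_term_le:
  fixes y t :: real
  assumes "\<bar>t\<bar> < 1"
  shows "\<bar>pochhammer y n * t ^ n / fact n\<bar> \<le> (1 / (1 - \<bar>t\<bar>)) powr \<bar>y\<bar>"
proof -
  have "\<bar>pochhammer y n * t ^ n / fact n\<bar> \<le> (\<Sum>n<Suc n. \<bar>pochhammer y n * t ^ n / fact n\<bar>)"
    by (rule member_le_sum) auto
  also have "\<dots> \<le> (1 / (1 - \<bar>t\<bar>)) powr \<bar>y\<bar>"
    by (rule pochhammer_partial_sum_le[OF assms])
  finally show ?thesis .
qed

lemma borel_measurable_pochhammer [measurable (raw)]:
  fixes Y :: "'a \<Rightarrow> real"
  assumes [measurable]: "Y \<in> borel_measurable M"
  shows "(\<lambda>\<omega>. pochhammer (Y \<omega>) n) \<in> borel_measurable M"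
  unfolding pochhammer_prod by measurable

lemma expectation_pochhammer_sums:
  fixes Y :: "'a \<Rightarrow> real"
  assumes [measurable]: "Y \<in> borel_measurable M"
    and exp_int: "\<And>t. \<bar>t\<bar> < r \<Longrightarrow> integrable M (\<lambda>\<omega>. exp (t * Y \<omega>))"
    and t: "\<bar>t\<bar> < 1 - exp (- r)"
  shows "(\<lambda>n. (\<integral>\<omega>. pochhammer (Y \<omega>) n \<partial>M) / fact n * t ^ n)
    sums (\<integral>\<omega>. (1 / (1 - t)) powr Y \<omega> \<partial>M)"
proof -
  define w where "w \<omega> = (1 / (1 - \<bar>t\<bar>)) powr \<bar>Y \<omega>\<bar>" for \<omega>
  have t1: "\<bar>t\<bar> < 1"
    using t exp_gt_zero[of "- r"] by linarith
  have w: "integrable M w"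
    unfolding w_def by (rule powr_abs_integrable) (use assms in auto)
  \<comment> \<open>Integrability of the single terms is what allows the integral of each partial
    sum to be split at the end.\<close>
  have int: "integrable M (\<lambda>\<omega>. pochhammer (Y \<omega>) n * t ^ n / fact n)" for n
    using w by (rule Bochner_Integration.integrable_bound)
      (use pochhammer_term_le[OF t1] in \<open>auto simp: w_def\<close>)
  have "(\<lambda>N. \<integral>\<omega>. (\<Sum>n<N. pochhammer (Y \<omega>) n * t ^ n / fact n) \<partial>M)
      \<longlonglongrightarrow> (\<integral>\<omega>. (1 / (1 - t)) powr Y \<omega> \<partial>M)"
  proof (rule integral_dominated_convergence[OF _ _ w])
    show "AE \<omega> in M. (\<lambda>N. \<Sum>n<N. pochhammer (Y \<omega>) n * t ^ n / fact n)
        \<longlonglongrightarrow> (1 / (1 - t)) powr Y \<omega>"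
      using pochhammer_sums_powr[OF t1] by (simp add: sums_def)
    show "AE \<omega> in M. norm (\<Sum>n<N. pochhammer (Y \<omega>) n * t ^ n / fact n) \<le> w \<omega>" for N
      unfolding w_def real_norm_def
      by (intro AE_I2 order_trans[OF sum_abs pochhammer_partial_sum_le[OF t1]])
  qed measurable
  then show ?thesis
    by (simp add: Bochner_Integration.integral_sum[OF int] sums_def)
qed

definition rising_moment_fps :: "'a measure \<Rightarrow> ('a \<Rightarrow> real) \<Rightarrow> real fps" where
  "rising_moment_fps M Y = Abs_fps (\<lambda>n. (\<integral>\<omega>. pochhammer (Y \<omega>) n \<partial>M) / fact n)"

lemma expectation_powr_has_fps_expansion:
  fixes Y :: "'a \<Rightarrow> real"
  assumes "Y \<in> borel_measurable M" and "r > 0"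
    and "\<And>t. \<bar>t\<bar> < r \<Longrightarrow> integrable M (\<lambda>\<omega>. exp (t * Y \<omega>))"
  shows "(\<lambda>t. \<integral>\<omega>. (1 / (1 - t)) powr Y \<omega> \<partial>M) has_fps_expansion rising_moment_fps M Y"
proof (rule has_fps_expansionI)
  have "\<forall>\<^sub>F t in nhds (0::real). t \<in> ball 0 (1 - exp (- r))"
    using \<open>r > 0\<close> by (intro eventually_nhds_in_open) auto
  then show "\<forall>\<^sub>F t in nhds 0. (\<lambda>n. fps_nth (rising_moment_fps M Y) n * t ^ n)
      sums (\<integral>\<omega>. (1 / (1 - t)) powr Y \<omega> \<partial>M)"
    by eventually_elim
      (use expectation_pochhammer_sums[OF assms(1,3)] in \<open>simp add: rising_moment_fps_def\<close>)
qed

text \<open>Uniqueness of power series expansions determines \<open>c\<close>, so the definite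
  description in \<open>prob_lah\<close> has exactly one candidate.\<close>

lemma is_lah_expansion_iff:
  assumes "lah_gf M Y k has_fps_expansion F" and "\<And>n. n < k \<Longrightarrow> fps_nth F n = 0"
  shows "is_lah_expansion M Y k c \<longleftrightarrow> c = (\<lambda>n. fact n * fps_nth F n)"
proof -
  \<comment> \<open>Starting the series at \<open>k\<close> loses nothing, since the skipped terms
    are zero.\<close>
  have drop_zeros: "(\<lambda>i. c (i + k) * (t ^ (i + k) / fact (i + k))) sums s
      \<longleftrightarrow> (\<lambda>n. c n / fact n * t ^ n) sums s"
    if "\<forall>n<k. c n = 0" for c :: "nat \<Rightarrow> real" and t s :: real
    using that sums_iff_shift[of "\<lambda>n. c n / fact n * t ^ n" k s] by simp
  show ?thesis
  proof
    assume "is_lah_expansion M Y k c"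
    then have "\<forall>\<^sub>F t in nhds 0. (\<lambda>n. c n / fact n * t ^ n) sums lah_gf M Y k t"
      unfolding is_lah_expansion_def by (metis (no_types, lifting) drop_zeros eventually_mono)
    then have "lah_gf M Y k has_fps_expansion Abs_fps (\<lambda>n. c n / fact n)"
      by (intro has_fps_expansionI) (simp only: fps_nth_Abs_fps)
    with assms(1) have "F = Abs_fps (\<lambda>n. c n / fact n)"
      by (rule has_fps_expansion_unique)
    then show "c = (\<lambda>n. fact n * fps_nth F n)"
      by simp
  next
    assume c: "c = (\<lambda>n. fact n * fps_nth F n)"
    with assms(2) have "\<forall>n<k. c n = 0"
      by simp
    moreover have "\<forall>\<^sub>F t in nhds 0. (\<lambda>n. c n / fact n * t ^ n) sums lah_gf M Y k t"
      using has_fps_expansion_imp_sums[OF assms(1)] by (simp add: c)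
    ultimately show "is_lah_expansion M Y k c"
      unfolding is_lah_expansion_def by (metis (no_types, lifting) drop_zeros eventually_mono)
  qed
qed

lemma prob_lah_eq:
  fixes Y :: "'a \<Rightarrow> real"
  assumes "prob_space M" "Y \<in> borel_measurable M" "r > 0"
    and "\<And>t. \<bar>t\<bar> < r \<Longrightarrow> integrable M (\<lambda>\<omega>. exp (t * Y \<omega>))"
  shows "prob_lah M Y n k = fact n / fact k * fps_nth ((rising_moment_fps M Y - 1) ^ k) n"
proof -
  interpret prob_space M by fact
  let ?G = "rising_moment_fps M Y - 1"
  \<comment> \<open>The zeroth rising moment is the total mass 1. Hence \<open>?G ^ k\<close> has no
    coefficients below index \<open>k\<close>, as the expansion demands.\<close>
  have "fps_nth ?G 0 = 0"
    by (simp add: rising_moment_fps_def prob_space)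
  moreover have "lah_gf M Y k has_fps_expansion fps_const (1 / fact k) * ?G ^ k"
    unfolding lah_gf_def[abs_def] using assms(2-4)
    by (intro has_fps_expansion_cmult_left has_fps_expansion_power has_fps_expansion_diff
        expectation_powr_has_fps_expansion has_fps_expansion_1)
  ultimately have "is_lah_expansion M Y k c
      \<longleftrightarrow> c = (\<lambda>n. fact n * fps_nth (fps_const (1 / fact k) * ?G ^ k) n)" for c
    by (intro is_lah_expansion_iff) (simp_all add: startsby_zero_power_prefix)
  then show ?thesis
    by (simp add: prob_lah_def)
qed

text \<open>The factor \<open>1 / fact k\<close> of the Lah numbers and \<open>x ^ k\<close> combine
  to the \<open>k\<close>-th coefficient of \<open>fps_exp x\<close>; coefficient \<open>n\<close>
  of the composition is a finite sum over \<open>k\<close> up to \<open>n\<close>.\<close>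

lemma prob_lah_bell_eq:
  fixes Y :: "'a \<Rightarrow> real"
  assumes "prob_space M" "Y \<in> borel_measurable M" "r > 0"
    and "\<And>t. \<bar>t\<bar> < r \<Longrightarrow> integrable M (\<lambda>\<omega>. exp (t * Y \<omega>))"
  shows "prob_lah_bell M Y n x = fact n * fps_nth (fps_exp x oo (rising_moment_fps M Y - 1)) n"
  by (simp add: prob_lah_bell_def prob_lah_eq[OF assms] fps_compose_nth sum_distrib_left mult_ac)

theorem theorem2p6:
  fixes M :: "'a measure" and Y :: "'a \<Rightarrow> real" and r x :: real and n :: nat
  assumes "prob_space M"
    and "Y \<in> borel_measurable M"
    and "r > 0"
    and "\<And>t. \<bar>t\<bar> < r \<Longrightarrow> integrable M (\<lambda>\<omega>. exp (t * Y \<omega>))"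
  shows "prob_lah_bell M Y (n + 1) x =
    x * (\<Sum>k=0..n. real (n choose k) * (\<integral>\<omega>. pochhammer (Y \<omega>) (k + 1) \<partial>M)
          * prob_lah_bell M Y (n - k) x)"
proof -
  interpret prob_space M by fact
  define G where "G = rising_moment_fps M Y - 1"
  define H where "H = fps_exp x oo G"
  have bell: "prob_lah_bell M Y m x = fact m * fps_nth H m" for m
    unfolding H_def G_def by (rule prob_lah_bell_eq[OF assms])
  have G0: "fps_nth G 0 = 0"
    by (simp add: G_def rising_moment_fps_def prob_space)
  \<comment> \<open>Chain rule for formal composition, valid because \<open>G\<close> has zero
    constant term.\<close>
  have "fps_deriv H = (fps_const x * fps_exp x oo G) * fps_deriv G"
    by (simp add: H_def fps_compose_deriv[OF G0])
  also have "\<dots> = fps_const x * (fps_deriv G * H)"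
    by (simp only: H_def fps_compose_mult_distrib[OF G0] fps_const_compose mult_ac)
  finally have "fps_deriv H = fps_const x * (fps_deriv G * H)" .
  \<comment> \<open>The factor \<open>k + 1\<close> from differentiation reduces
    \<open>fact (k + 1)\<close> to \<open>fact k\<close>; the subtracted 1 only affects the constant
    term of \<open>G\<close>.\<close>
  moreover have "fps_nth (fps_deriv G) k = (\<integral>\<omega>. pochhammer (Y \<omega>) (k + 1) \<partial>M) / fact k" for k
    by (simp add: G_def rising_moment_fps_def field_simps del: of_nat_Suc)
  ultimately have deriv_H: "fps_nth (fps_deriv H) n =
      x * (\<Sum>k=0..n. (\<integral>\<omega>. pochhammer (Y \<omega>) (k + 1) \<partial>M) / fact k * fps_nth H (n - k))"
    by (simp add: fps_mult_nth[of "fps_deriv G"] del: fps_deriv_nth)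
  have "prob_lah_bell M Y (n + 1) x = fact n * fps_nth (fps_deriv H) n"
    by (simp add: bell)
  also have "\<dots> = x * (\<Sum>k=0..n. real (n choose k) * (\<integral>\<omega>. pochhammer (Y \<omega>) (k + 1) \<partial>M)
          * prob_lah_bell M Y (n - k) x)"
    \<comment> \<open>Inside the sum, \<open>fact n / fact k\<close> equals
      \<open>(n choose k) * fact (n - k)\<close>, and \<open>fact (n - k)\<close> turns the
      coefficient of \<open>H\<close> back into a Lah-Bell polynomial.\<close>
    unfolding deriv_H mult.left_commute[of "fact n"] sum_distrib_left[of "fact n"]
    by (intro arg_cong[of _ _ "(*) x"] sum.cong refl) (simp add: bell binomial_fact)
  finally show ?thesis .
qed

end
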